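(* Let $k\ge 3$ be an integer, let $G=(V,E)$ be a graph and let $\mathbf w:E\to\mathbb Z_{+}$ be an edge weight function. Write $N=\binom{k}{2}$. Let $E_k$ be the edge set produced by the following algorithm: (1) Let $\hat{\mathbf x}^*$ be an optimal solution of the linear program $\min\{\mathbf w^T\mathbf x : A\mathbf x\ge \mathbf 1,\ 0\le \mathbf x\le 1\}$, where $A$ is the $k$-clique--edge incidence matrix of $G$ (rows indexed by the $k$-cliques of $G$, columns by the edges, entry $1$ iff the edge lies in the clique). (2) Let $E_{k_1}=\{e\in E : \hat{\mathbf x}^*_e\ge 2/(2N-1)\}$. (3) Let $E'$ be the set of edges lying in some $k$-clique of $G-E_{k_1}$, and let $G'$ be the subgraph of $G$ formed by the edge set $E'$. (4) Choose any bipartite subgraph $B=(V_1,V_2,E_B)$ of $G'$ with $\mathbf w(E_B)\ge \tfrac12\mathbf w(E')$, and let $E_{k_2}=E'\setminus E_B$. (5) Output $E_k=E_{k_1}\cup E_{k_2}$. Then $E_k$ is a $k$-clique covering of $G$ and $\mathbf w(E_k)\le \frac{k^2-k-1}{2}\,\widetilde{\tau_k}(G_w)$.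
   Context: A $k$-clique covering of $G$ is an edge subset $A\subseteq E$ such that $G-A$ contains no complete subgraph on $k$ vertices. The weighted covering number $\widetilde{\tau_k}(G_w)$ is the minimum of $\sum_{e\in A}\mathbf w_e$ over all $k$-clique coverings $A$ of $G$, equivalently $\min\{\mathbf w^T\mathbf x: A\mathbf x\ge\mathbf 1,\ \mathbf x\in\{0,1\}^{E}\}$ with $A$ the $k$-clique--edge incidence matrix. For $F\subseteq E$, $\mathbf w(F)=\sum_{e\in F}\mathbf w_e$. Note $\frac{k^2-k-1}{2}=\binom{k}{2}-\frac12$. *)

theory Defs
  imports Complex_Main "HOL-Library.Ramsey"
begin

definition finite_graph :: "'a set \<Rightarrow> 'a set set \<Rightarrow> bool" where
  "finite_graph V E \<longleftrightarrow> finite V \<and> E \<subseteq> [V]\<^bsup>2\<^esup>"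

text \<open>In a simple graph a complete subgraph is identified with its vertex set.\<close>

definition k_cliques :: "nat \<Rightarrow> 'a set \<Rightarrow> 'a set set \<Rightarrow> 'a set set" where
  "k_cliques k V E = {Q \<in> [V]\<^bsup>k\<^esup>. clique Q E}"

definition clique_covering :: "nat \<Rightarrow> 'a set \<Rightarrow> 'a set set \<Rightarrow> 'a set set \<Rightarrow> bool" where
  "clique_covering k V E A \<longleftrightarrow> A \<subseteq> E \<and> k_cliques k V (E - A) = {}"

definition weighted_covering_number ::
    "nat \<Rightarrow> 'a set \<Rightarrow> 'a set set \<Rightarrow> ('a set \<Rightarrow> nat) \<Rightarrow> nat" where
  "weighted_covering_number k V E w = Min (sum w ` {A. clique_covering k V E A})"

definition incidence :: "'a set \<Rightarrow> 'a set \<Rightarrow> real" where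
  "incidence Q e = (if e \<subseteq> Q then 1 else 0)"

text \<open>A vector indexed by the edges is a function of which only the values on \<open>E\<close> matter.\<close>

definition lp_feasible ::
    "nat \<Rightarrow> 'a set \<Rightarrow> 'a set set \<Rightarrow> ('a set \<Rightarrow> real) \<Rightarrow> bool" where
  "lp_feasible k V E x \<longleftrightarrow>
     (\<forall>Q \<in> k_cliques k V E. (\<Sum>e\<in>E. incidence Q e * x e) \<ge> 1) \<and>
     (\<forall>e\<in>E. 0 \<le> x e \<and> x e \<le> 1)"

definition lp_optimal ::
    "nat \<Rightarrow> 'a set \<Rightarrow> 'a set set \<Rightarrow> ('a set \<Rightarrow> nat) \<Rightarrow> ('a set \<Rightarrow> real) \<Rightarrow> bool" where
  "lp_optimal k V E w x \<longleftrightarrow>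
     is_arg_min (\<lambda>y. \<Sum>e\<in>E. real (w e) * y e) (lp_feasible k V E) x"

definition bipartite_subgraph ::
    "'a set \<Rightarrow> 'a set \<Rightarrow> 'a set set \<Rightarrow> 'a set \<Rightarrow> 'a set set \<Rightarrow> bool" where
  "bipartite_subgraph V1 V2 F V E \<longleftrightarrow>
     V1 \<inter> V2 = {} \<and> V1 \<union> V2 \<subseteq> V \<and> F \<subseteq> E \<and> (\<forall>e\<in>F. \<exists>u\<in>V1. \<exists>v\<in>V2. e = {u, v})"

text \<open>The minimum in the weighted covering number is taken over a finite nonempty set.\<close>

lemma weighted_covering_number_attained:
  assumes "finite_graph V E" "k \<ge> 2"
  shows "\<exists>A. clique_covering k V E A \<and> weighted_covering_number k V E w = sum w A"
proof -
  have "finite ([V]\<^bsup>2\<^esup>)"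
    using assms(1) by (simp add: finite_graph_def finite_imp_finite_nsets)
  then have "finite E"
    using assms(1) finite_subset by (auto simp: finite_graph_def)
  then have "finite {A. clique_covering k V E A}"
    by (auto intro: finite_subset[of _ "Pow E"] simp: clique_covering_def)
  moreover have "\<not> clique Q {}" if "Q \<in> [V]\<^bsup>k\<^esup>" for Q
  proof -
    have "\<not> card Q \<le> Suc 0" "finite Q"
      using that assms(2) by (auto simp: nsets_def)
    then show ?thesis
      by (auto simp: clique_def card_le_Suc0_iff_eq)
  qed
  then have "clique_covering k V E E"
    by (auto simp: clique_covering_def k_cliques_def)
  ultimately have "weighted_covering_number k V E w \<in> sum w ` {A. clique_covering k V E A}"
    unfolding weighted_covering_number_def by (intro Min_in) auto
  then show ?thesis by auto
qed

end

theory Submission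
  imports Defs
begin

text \<open>
  Write \<open>c = 1 / (2N - 1)\<close>. Every \<open>k\<close>-clique left after removing the edges of LP value at least
  \<open>2c\<close> has \<open>N\<close> edges of value below \<open>2c\<close> and total value at least \<open>1\<close>, so each of its edges has
  value above \<open>1 - (N - 1) 2c = c\<close>. Hence rounding up the edges of the first phase, and half of
  the weight of those of the second, both cost at most \<open>1 / (2c) = N - 1/2\<close> times their share of
  the LP optimum, which is at most the covering number. What survives both phases is
  bipartite, hence triangle-free.
\<close>

lemma finite_graph_imp_finite_edges:
  assumes "finite_graph V E"
  shows "finite E"
  using assms unfolding finite_graph_def
  by (elim conjE) (rule finite_subset, assumption, rule finite_imp_finite_nsets)

lemma k_cliques_mono:
  assumes "F \<subseteq> E"
  shows "k_cliques k V F \<subseteq> k_cliques k V E"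
  using assms by (auto simp: k_cliques_def clique_def)

text \<open>The right-hand side does not mention \<open>E\<close>: any two edge sets in which
  \<open>Q\<close> is a clique have the same edges inside \<open>Q\<close>. This is what later
  allows passing from \<open>E\<close> to a subset of it.\<close>

lemma edges_within_clique:
  assumes "E \<subseteq> [V]\<^bsup>2\<^esup>" "Q \<in> k_cliques k V E"
  shows "{e \<in> E. e \<subseteq> Q} = [Q]\<^bsup>2\<^esup>"
proof
  show "{e \<in> E. e \<subseteq> Q} \<subseteq> [Q]\<^bsup>2\<^esup>"
    using assms(1) by (auto simp: nsets_def)
  show "[Q]\<^bsup>2\<^esup> \<subseteq> {e \<in> E. e \<subseteq> Q}"
    using assms(2) by (auto simp: nsets_def card_2_iff k_cliques_def clique_def)
qed

lemma card_edges_within_clique: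
  assumes "E \<subseteq> [V]\<^bsup>2\<^esup>" "Q \<in> k_cliques k V E"
  shows "card {e \<in> E. e \<subseteq> Q} = k choose 2"
proof -
  have "card Q = k"
    using assms(2) by (simp add: k_cliques_def nsets_def)
  then show ?thesis
    unfolding edges_within_clique[OF assms] by simp
qed

lemma sum_incidence:
  assumes "finite E"
  shows "(\<Sum>e\<in>E. incidence Q e * x e) = (\<Sum>e | e \<in> E \<and> e \<subseteq> Q. x e)"
  unfolding sum.inter_filter[OF assms] by (intro sum.cong) (auto simp: incidence_def)

text \<open>The 0/1 indicator \<open>y\<close> of a minimum covering \<open>A\<close> is feasible
  for the linear program, and its objective value is the weight of \<open>A\<close>.\<close>

lemma lp_optimal_le_weighted_covering_number:
  assumes "finite_graph V E" "k \<ge> 2" "lp_optimal k V E w x"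
  shows "(\<Sum>e\<in>E. real (w e) * x e) \<le> real (weighted_covering_number k V E w)"
proof -
  obtain A where A: "clique_covering k V E A" "weighted_covering_number k V E w = sum w A"
    using weighted_covering_number_attained[OF assms(1,2)] by blast
  have fin: "finite E"
    using assms(1) by (rule finite_graph_imp_finite_edges)
  have "A \<subseteq> E"
    using A(1) by (simp add: clique_covering_def)
  define y :: "'a set \<Rightarrow> real" where "y e = of_bool (e \<in> A)" for e
  have "(\<Sum>e\<in>E. incidence Q e * y e) \<ge> 1" if Q: "Q \<in> k_cliques k V E" for Q
  proof -
    \<comment> \<open>\<open>Q\<close> is a clique of \<open>E\<close> but not of
      \<open>E - A\<close>, so one of its edges lies in \<open>A\<close>; that edge alone
      contributes 1 and all other terms are nonnegative.\<close>
    have "Q \<notin> k_cliques k V (E - A)"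
      using A(1) by (simp add: clique_covering_def)
    then obtain u v where "u \<in> Q" "v \<in> Q" "{u, v} \<in> A"
      using Q unfolding k_cliques_def clique_def by blast
    then obtain e where e: "e \<in> A" "e \<subseteq> Q"
      by blast
    then have "1 = (\<Sum>d\<in>{e}. incidence Q d * y d)"
      by (simp add: incidence_def y_def)
    also have "\<dots> \<le> (\<Sum>d\<in>E. incidence Q d * y d)"
      using e \<open>A \<subseteq> E\<close> fin by (intro sum_mono2) (auto simp: incidence_def y_def)
    finally show ?thesis .
  qed
  then have "lp_feasible k V E y"
    by (auto simp: lp_feasible_def y_def)
  then have "(\<Sum>e\<in>E. real (w e) * x e) \<le> (\<Sum>e\<in>E. real (w e) * y e)"
    using assms(3) by (auto simp: lp_optimal_def is_arg_min_linorder)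
  also have "\<dots> = (\<Sum>e\<in>A. real (w e))"
    unfolding y_def using fin \<open>A \<subseteq> E\<close>
    by (simp add: of_bool_def if_distrib sum.If_cases Int_absorb1 cong: if_cong)
  finally show ?thesis
    using A(2) by simp
qed

text \<open>The LP constraint of \<open>Q\<close> makes the values of its edges sum to at least 1,
  and each edge other than \<open>e\<close> contributes at most \<open>b\<close>.\<close>

lemma lp_value_lower_bound:
  assumes "finite_graph V E" "lp_feasible k V E x" "F \<subseteq> E"
    and small: "\<And>e. e \<in> F \<Longrightarrow> x e \<le> b"
    and Q: "Q \<in> k_cliques k V F" and e: "e \<in> F" "e \<subseteq> Q"
  shows "x e \<ge> 1 - (real (k choose 2) - 1) * b"
proof -
  have EV: "E \<subseteq> [V]\<^bsup>2\<^esup>" and FV: "F \<subseteq> [V]\<^bsup>2\<^esup>"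
    using assms(1,3) by (auto simp: finite_graph_def)
  have fin: "finite E"
    using assms(1) by (rule finite_graph_imp_finite_edges)
  then have finF: "finite F"
    using assms(3) by (rule rev_finite_subset)
  have QE: "Q \<in> k_cliques k V E"
    using k_cliques_mono[OF assms(3)] Q by blast
  define D where "D = {e \<in> F. e \<subseteq> Q}"
  \<comment> \<open>The constraint sums over the edges of \<open>E\<close> inside \<open>Q\<close>,
    while the bound \<open>b\<close> is known only on \<open>F\<close>; both edge sets consist of
    all pairs of \<open>Q\<close>.\<close>
  have D: "D = {e \<in> E. e \<subseteq> Q}"
    unfolding D_def edges_within_clique[OF EV QE] edges_within_clique[OF FV Q] ..
  have card: "card D = k choose 2"
    unfolding D_def by (rule card_edges_within_clique[OF FV Q])
  have finD: "finite D" and eD: "e \<in> D"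
    using finF e by (auto simp: D_def)
  have "1 \<le> sum x D"
    using assms(2) QE by (auto simp: lp_feasible_def sum_incidence[OF fin] D)
  also have "\<dots> = x e + sum x (D - {e})"
    using finD eD by (rule sum.remove)
  also have "sum x (D - {e}) \<le> of_nat (card (D - {e})) * b"
    using small by (intro sum_bounded_above) (auto simp: D_def)
  also have "real (card (D - {e})) = real (k choose 2) - 1"
  proof -
    have "card D = Suc (card (D - {e}))"
      using finD eD by (rule card.remove)
    then show ?thesis using card by simp
  qed
  finally show ?thesis by simp
qed

text \<open>Among three vertices of a clique two would lie on the same side, yet they are
  adjacent.\<close>

lemma bipartite_subgraph_no_k_cliques:
  assumes "bipartite_subgraph V1 V2 F W E" "k \<ge> 3"
  shows "k_cliques k V F = {}"
proof (rule ccontr)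
  assume "k_cliques k V F \<noteq> {}"
  then obtain Q where Q: "clique Q F" "card Q \<ge> 3"
    using assms(2) by (auto simp: k_cliques_def nsets_def)
  then obtain T where "T \<subseteq> Q" "card T = 3"
    using obtain_subset_with_card_n by metis
  then obtain a b c where "a \<in> Q" "b \<in> Q" "c \<in> Q" "a \<noteq> b" "b \<noteq> c" "a \<noteq> c"
    by (auto simp: card_3_iff)
  then have "{a, b} \<in> F" "{b, c} \<in> F" "{a, c} \<in> F"
    using Q(1) by (auto simp: clique_def)
  moreover have "(u \<in> V1 \<and> v \<in> V2) \<or> (u \<in> V2 \<and> v \<in> V1)" if "{u, v} \<in> F" for u v
  proof -
    have "\<forall>e\<in>F. \<exists>u\<in>V1. \<exists>v\<in>V2. e = {u, v}"
      using assms(1) by (simp add: bipartite_subgraph_def)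
    from bspec[OF this that] show ?thesis
      by (auto simp: doubleton_eq_iff)
  qed
  moreover have "V1 \<inter> V2 = {}"
    using assms(1) by (simp add: bipartite_subgraph_def)
  ultimately show False by blast
qed

theorem theorem3:
  fixes V :: "'a set" and E :: "'a set set" and w :: "'a set \<Rightarrow> nat"
    and k N :: nat and x :: "'a set \<Rightarrow> real"
    and Ek1 E' Ek2 Ek EB :: "'a set set" and V1 V2 :: "'a set"
  assumes "k \<ge> 3"
    and "finite_graph V E"
    and "N = k choose 2"
    and "lp_optimal k V E w x"
    and "Ek1 = {e \<in> E. x e \<ge> 2 / (2 * real N - 1)}"
    and "E' = {e \<in> E - Ek1. \<exists>Q \<in> k_cliques k V (E - Ek1). e \<subseteq> Q}"
    and "bipartite_subgraph V1 V2 EB (\<Union>E') E'"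
    and "real (sum w EB) \<ge> 1 / 2 * real (sum w E')"
    and "Ek2 = E' - EB"
    and "Ek = Ek1 \<union> Ek2"
  shows "clique_covering k V E Ek \<and>
    real (sum w Ek) \<le> ((real k)\<^sup>2 - real k - 1) / 2 * real (weighted_covering_number k V E w)"
proof
  have feas: "lp_feasible k V E x"
    using assms(4) by (simp add: lp_optimal_def is_arg_min_def)
  have fin: "finite E"
    using assms(2) by (rule finite_graph_imp_finite_edges)
  have sub: "Ek1 \<subseteq> E" "E' \<subseteq> E" "Ek1 \<inter> E' = {}" "EB \<subseteq> E'"
    using assms(5-7) by (auto simp: bipartite_subgraph_def)
  then have fins: "finite Ek1" "finite E'" "finite EB"
    using fin by (meson finite_subset)+

  \<comment> \<open>A clique avoiding \<open>Ek\<close> also avoids \<open>Ek1\<close>, so all its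
    edges lie in \<open>E'\<close>; not being in \<open>Ek2\<close>, they lie in
    \<open>EB\<close>.\<close>
  have "k_cliques k V (E - Ek) \<subseteq> k_cliques k V EB"
  proof
    fix Q assume Q: "Q \<in> k_cliques k V (E - Ek)"
    then have "Q \<in> k_cliques k V (E - Ek1)"
      using k_cliques_mono[of "E - Ek" "E - Ek1"] assms(10) by blast
    then have "{u, v} \<in> EB" if "u \<in> Q" "v \<in> Q" "{u, v} \<in> E - Ek" for u v
      using that assms(6,9,10) by blast
    then show "Q \<in> k_cliques k V EB"
      using Q by (auto simp: k_cliques_def clique_def)
  qed
  then show "clique_covering k V E Ek"
    using bipartite_subgraph_no_k_cliques[OF assms(7,1)] sub assms(9,10)
    by (auto simp: clique_covering_def)

  \<comment> \<open>The rounding threshold is \<open>2 / M\<close> and the claimed factor is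
    \<open>M / 2\<close>.\<close>
  define M where "M = 2 * real N - 1"
  have M: "M = (real k)\<^sup>2 - real k - 1"
  proof -
    \<comment> \<open>Evenness makes the natural-number division by 2 in the binomial coefficient
      exact.\<close>
    have "even (k * (k - 1))" by auto
    then have "2 * N = k * (k - 1)"
      unfolding assms(3) choose_two by simp
    then have "real (2 * N) = real (k * (k - 1))"
      by simp
    then have "2 * real N = real k * (real k - 1)"
      using assms(1) by (simp add: of_nat_diff)
    then show ?thesis
      by (simp add: M_def power2_eq_square algebra_simps)
  qed
  have "real k * 3 \<le> real k * real k"
    using assms(1) by (intro mult_left_mono) auto
  then have "M > 0"
    using assms(1) unfolding M power2_eq_square by linarith

  have big: "real (w e) \<le> M / 2 * (real (w e) * x e)" if "e \<in> Ek1" for e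
  proof -
    have "2 / M \<le> x e"
      using that assms(5) by (simp add: M_def)
    then have "1 \<le> M / 2 * x e"
      using \<open>M > 0\<close> by (simp add: field_simps)
    then have "real (w e) * 1 \<le> real (w e) * (M / 2 * x e)"
      by (intro mult_left_mono) auto
    then show ?thesis by (simp add: algebra_simps)
  qed
  have half: "real (w e) / 2 \<le> M / 2 * (real (w e) * x e)" if eE': "e \<in> E'" for e
  proof -
    obtain Q where "Q \<in> k_cliques k V (E - Ek1)" "e \<subseteq> Q" "e \<in> E - Ek1"
      using eE' assms(6) by blast
    moreover have "x d \<le> 2 / M" if "d \<in> E - Ek1" for d
      using that assms(5) by (auto simp: M_def)
    ultimately have "1 - (real N - 1) * (2 / M) \<le> x e"
      unfolding assms(3) by (intro lp_value_lower_bound[OF assms(2) feas Diff_subset])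
    \<comment> \<open>Here \<open>2 * (N - 1) = M - 1\<close>. The threshold is thus twice the lower
      bound that it leaves on \<open>E'\<close>.\<close>
    moreover have "1 - (real N - 1) * (2 / M) = 1 / M"
      using \<open>M > 0\<close> by (simp add: field_simps) (simp add: M_def)
    ultimately have "1 \<le> M * x e"
      using \<open>M > 0\<close> by (simp add: field_simps)
    then have "real (w e) * 1 \<le> real (w e) * (M * x e)"
      by (intro mult_left_mono) auto
    then show ?thesis by (simp add: algebra_simps)
  qed

  have "real (sum w Ek) = real (sum w Ek1) + real (sum w (E' - EB))"
    using assms(9,10) sub fins by (subst assms(10), subst sum.union_disjoint) auto
  also have "real (sum w (E' - EB)) = real (sum w E') - real (sum w EB)"
    using sub(4) fins(2) by (simp add: sum_diff[of E' EB "\<lambda>e. real (w e)"])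
  \<comment> \<open>At most half of the weight of \<open>E'\<close> is output, and this half is
    spread over all edges of \<open>E'\<close>, those of \<open>EB\<close> included.\<close>
  also have "real (sum w Ek1) + (real (sum w E') - real (sum w EB))
      \<le> (\<Sum>e\<in>Ek1. real (w e)) + (\<Sum>e\<in>E'. real (w e) / 2)"
    using assms(8) by (simp flip: sum_divide_distrib)
  also have "\<dots> \<le> (\<Sum>e\<in>Ek1. M / 2 * (real (w e) * x e)) + (\<Sum>e\<in>E'. M / 2 * (real (w e) * x e))"
    by (intro add_mono sum_mono big half)
  \<comment> \<open>\<open>Ek1\<close> and \<open>E'\<close> are disjoint, so no edge is charged
    twice; the remaining edges of \<open>E\<close> can then be added because \<open>x\<close> is
    nonnegative.\<close>
  also have "\<dots> = (\<Sum>e\<in>Ek1 \<union> E'. M / 2 * (real (w e) * x e))"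
    using sub(3) fins by (simp add: sum.union_disjoint)
  also have "\<dots> \<le> (\<Sum>e\<in>E. M / 2 * (real (w e) * x e))"
    using fin sub \<open>M > 0\<close> feas by (intro sum_mono2) (auto simp: lp_feasible_def)
  also have "\<dots> = M / 2 * (\<Sum>e\<in>E. real (w e) * x e)"
    by (simp add: sum_distrib_left)
  also have "\<dots> \<le> M / 2 * real (weighted_covering_number k V E w)"
    using lp_optimal_le_weighted_covering_number[OF assms(2) _ assms(4)] assms(1) \<open>M > 0\<close>
    by (intro mult_left_mono) auto
  finally show "real (sum w Ek)
      \<le> ((real k)\<^sup>2 - real k - 1) / 2 * real (weighted_covering_number k V E w)"
    by (simp add: M)
qed

end
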